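(* Let $A\in\mathbb{C}^{n\times n}$, $D\in\mathbb{C}^{m\times m}$, $B\in\mathbb{C}^{m\times n}$, $C\in\mathbb{C}^{n\times m}$, and put $S=A-CD^{d}B$, $Z=D-BA^{d}C$, $S_{A}=AA^{d}SAA^{d}$, $k=\operatorname{ind}(A)$, $s=\operatorname{ind}(Z)$. If $A^{\pi}CD^{d}B=0$, $D^{\pi}BA^{d}C=0$ and $D^{d}BAA^{d}=D^{d}DBA^{d}$, then $$S^{d}=S_{A}^{d}+\sum_{i=0}^{k-1}(S_{A}^{d})^{i+2}SA^{i}A^{\pi},$$ where $$S_{A}^{d}=A^{d}+A^{d}CZ^{d}D^{d}BAA^{d}-\sum_{i=0}^{s-1}(A^{d})^{i+2}CDD^{d}Z^{i}Z^{\pi}D^{d}BAA^{d}.$$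
   Context: For a square complex matrix $X$, $\operatorname{ind}(X)$ is the smallest non-negative integer $k$ with $\operatorname{rank}(X^{k})=\operatorname{rank}(X^{k+1})$, and the Drazin inverse $X^{d}$ is the unique matrix with $XX^{d}=X^{d}X$, $X^{d}XX^{d}=X^{d}$, $X^{k}=X^{k+1}X^{d}$ for $k=\operatorname{ind}(X)$. Write $X^{\pi}=I-XX^{d}$. Conventions: $X^{0}=I$ for every square matrix $X$, and $\sum_{i=0}^{k}\ast=0$ if $k<0$. $S_A^d$ denotes the Drazin inverse of $S_A$. *)

theory Defs
  imports "HOL-Analysis.Analysis"
begin

(* The class operations * and ^ on the type of vectors act componentwise, so powers with
   respect to the matrix product ** have to be introduced separately. *)
primrec mat_pow :: "'a::semiring_1 ^ 'n ^ 'n \<Rightarrow> nat \<Rightarrow> 'a ^ 'n ^ 'n" where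
  "mat_pow X 0 = mat 1"
| "mat_pow X (Suc k) = X ** mat_pow X k"

definition mat_index :: "'a::field ^ 'n ^ 'n \<Rightarrow> nat" where
  "mat_index X = (LEAST k. rank (mat_pow X k) = rank (mat_pow X (k + 1)))"

definition is_drazin_inverse :: "'a::field ^ 'n ^ 'n \<Rightarrow> 'a ^ 'n ^ 'n \<Rightarrow> bool" where
  "is_drazin_inverse X Y \<longleftrightarrow>
     X ** Y = Y ** X \<and>
     Y ** X ** Y = Y \<and>
     mat_pow X (mat_index X) = mat_pow X (mat_index X + 1) ** Y"

definition drazin :: "'a::field ^ 'n ^ 'n \<Rightarrow> 'a ^ 'n ^ 'n" where
  "drazin X = (THE Y. is_drazin_inverse X Y)"

(* The spectral idempotent of X at 0, written X with superscript pi in the literature. *)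
definition drazin_proj :: "'a::field ^ 'n ^ 'n \<Rightarrow> 'a ^ 'n ^ 'n" where
  "drazin_proj X = mat 1 - X ** drazin X"

end

(* With P = A A^d and V = D^d B P, the hypotheses give (1 - P) S = (1 - P) A and S P = S_A, so S is
   block triangular with diagonal blocks S_A and the nilpotent part of A; this yields the first
   formula. They also give S_A = A P - C V and Z V = V S_A. Hence Z^d V = V S_A^d and
   Z^i Z^pi V = V S_A^i S_A^pi, and substituting C V = A P - S_A makes the sum in the second formula
   telescope. *)
theory Submission
  imports Defs
begin

section \<open>Distributive laws and powers for the matrix product\<close>

lemma mat_diff_ldistrib: "A ** (B - C) = A ** B - A ** (C :: 'a::ring_1 ^ 'p ^ 'n)"
  by (simp add: matrix_matrix_mult_def vec_eq_iff right_diff_distrib sum_subtractf)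

lemma mat_diff_rdistrib: "(A - B) ** C = A ** C - B ** (C :: 'a::ring_1 ^ 'p ^ 'n)"
  by (simp add: matrix_matrix_mult_def vec_eq_iff left_diff_distrib sum_subtractf)

lemma mat_add_rdistrib: "(A + B) ** C = A ** C + B ** (C :: 'a::semiring_1 ^ 'p ^ 'n)"
  by (simp add: matrix_matrix_mult_def vec_eq_iff distrib_right sum.distrib)

lemma mat_mult_zero_left [simp]: "0 ** (C :: 'a::semiring_1 ^ 'p ^ 'n) = 0"
  by (simp add: matrix_matrix_mult_def vec_eq_iff)

lemma mat_mult_zero_right [simp]: "(C :: 'a::semiring_1 ^ 'p ^ 'n) ** 0 = 0"
  by (simp add: matrix_matrix_mult_def vec_eq_iff)

lemma mat_sum_ldistrib: "A ** (\<Sum>i\<in>I. f i) = (\<Sum>i\<in>I. A ** (f i :: 'a::semiring_1 ^ 'p ^ 'n))"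
  by (induction I rule: infinite_finite_induct) (simp_all add: matrix_add_ldistrib)

lemma mat_sum_rdistrib: "(\<Sum>i\<in>I. f i) ** B = (\<Sum>i\<in>I. f i ** (B :: 'a::semiring_1 ^ 'p ^ 'n))"
  by (induction I rule: infinite_finite_induct) (simp_all add: mat_add_rdistrib)

lemma mat_pow_add: "mat_pow X (m + n) = mat_pow X m ** mat_pow X n"
  by (induction m) (simp_all add: matrix_mul_assoc)

lemma mat_pow_Suc2: "mat_pow X (Suc n) = mat_pow X n ** X"
  using mat_pow_add [of X n 1] by simp

text \<open>With \<open>Y = X\<close> this is also the rule that moves powers of \<open>X\<close>
  past a matrix commuting with \<open>X\<close>.\<close>

lemma mat_pow_intertwine:
  assumes "X ** V = V ** Y"
  shows "mat_pow X n ** V = V ** mat_pow Y n"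
proof (induction n)
  case (Suc n)
  then show ?case
    using assms by (metis mat_pow.simps(2) matrix_mul_assoc)
qed simp

text \<open>The factorization is substituted into itself: each round trades one more factor
  \<open>X\<close> for one more \<open>U\<close>.\<close>

lemma mat_pow_factor_right:
  assumes "mat_pow X k = mat_pow X (Suc k) ** U"
  shows "mat_pow X k = mat_pow X (k + n) ** mat_pow U n"
proof (induction n)
  case (Suc n)
  have "mat_pow X (k + Suc n) ** mat_pow U (Suc n) = mat_pow X n ** (mat_pow X (Suc k) ** U) ** mat_pow U n"
    by (metis add.commute add_Suc_shift mat_pow.simps(2) mat_pow_add matrix_mul_assoc)
  also have "\<dots> = mat_pow X (k + n) ** mat_pow U n"
    by (metis assms add.commute mat_pow_add)
  finally show ?case using Suc by simp
qed simp

lemma mat_pow_factor_left: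
  assumes "mat_pow X k = V ** mat_pow X (Suc k)"
  shows "mat_pow X k = mat_pow V n ** mat_pow X (k + n)"
proof (induction n)
  case (Suc n)
  have "mat_pow V (Suc n) ** mat_pow X (k + Suc n) = mat_pow V n ** (V ** mat_pow X (Suc k)) ** mat_pow X n"
    by (metis add_Suc_shift mat_pow_Suc2 mat_pow_add matrix_mul_assoc)
  also have "\<dots> = mat_pow V n ** mat_pow X (k + n)"
    by (metis assms mat_pow_add matrix_mul_assoc)
  finally show ?case using Suc by simp
qed simp

section \<open>Row spaces, ranges and one-sided factors\<close>

lemma span_rows_eq_range:
  fixes A :: "'a::field ^ 'n ^ 'm"
  shows "vec.span (rows A) = range (\<lambda>y. y v* A)"
proof
  have "vec.subspace (range (\<lambda>y. y v* A))"
    using vec.subspace_image [OF vec.subspace_UNIV, of "transpose A"] by simp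
  moreover have "row i A = axis i 1 v* A" for i
    by (simp add: row_def vector_matrix_mult_def vec_eq_iff axis_def mult_delta_left mult_delta_right)
  hence "rows A \<subseteq> range (\<lambda>y. y v* A)"
    by (auto simp: rows_def)
  ultimately show "vec.span (rows A) \<subseteq> range (\<lambda>y. y v* A)"
    by (rule vec.span_minimal [rotated])
  have "y v* A \<in> vec.span (rows A)" for y
  proof -
    have "y v* A = (\<Sum>i\<in>UNIV. y $ i *s row i A)"
      by (simp add: row_def vector_matrix_mult_def vec_eq_iff mult.commute)
    also have "\<dots> \<in> vec.span (rows A)"
      by (intro vec.span_sum vec.span_scale vec.span_base) (auto simp: rows_def)
    finally show ?thesis .
  qed
  then show "range (\<lambda>y. y v* A) \<subseteq> vec.span (rows A)" by blast
qed

lemma span_rows_mult_subset: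
  fixes B :: "'a::field ^ 'p ^ 'n"
  shows "vec.span (rows (A ** B)) \<subseteq> vec.span (rows B)"
  by (auto simp: span_rows_eq_range vector_matrix_mul_assoc [symmetric])

lemma rank_mult_le_right:
  fixes B :: "'a::field ^ 'p ^ 'n"
  shows "rank (A ** B) \<le> rank B"
  unfolding row_rank_def_gen
  by (metis span_rows_mult_subset vec.dim_span vec.dim_subset)

lemma rows_factor_imp_left_factor:
  fixes B :: "'a::field ^ 'p ^ 'n"
  assumes "\<And>i. row i B = f i v* M"
  shows "B = (\<chi> i. f i) ** M"
  using assms
  by (simp add: vec_eq_iff row_def vector_matrix_mult_def matrix_matrix_mult_def mult.commute)

text \<open>The row space of a product lies in that of its right factor, and equal rank makes the
  two coincide. So every row of \<open>B\<close> is a combination of rows of \<open>A ** B\<close>,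
  and the coefficient vectors are the rows of \<open>V\<close>.\<close>

lemma rank_mult_eq_imp_left_factor:
  fixes B :: "'a::field ^ 'p ^ 'n"
  assumes "rank (A ** B) = rank B"
  obtains V where "B = V ** (A ** B)"
proof -
  have "vec.span (rows (A ** B)) = vec.span (rows B)"
    using assms span_rows_mult_subset [of A B]
    by (intro vec.subspace_dim_equal vec.subspace_span) (simp_all add: row_rank_def_gen)
  moreover have "row i B \<in> vec.span (rows B)" for i
    by (rule vec.span_base) (auto simp: rows_def)
  ultimately have "row i B \<in> range (\<lambda>y. y v* (A ** B))" for i
    by (simp only: span_rows_eq_range [of "A ** B"])
  then have "\<exists>y. row i B = y v* (A ** B)" for i
    by blast
  then obtain f where f: "\<And>i. row i B = f i v* (A ** B)" by metis
  have "B = (\<chi> i. f i) ** (A ** B)"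
    using f by (rule rows_factor_imp_left_factor)
  then show thesis by (rule that)
qed

lemma range_subset_imp_right_factor:
  fixes A :: "'a::field ^ 'p ^ 'n"
  assumes "range ((*v) A) \<subseteq> range ((*v) B)"
  obtains U where "A = B ** U"
proof -
  have "\<exists>y. A *v axis i 1 = B *v y" for i
    using assms by blast
  then obtain f where f: "\<And>i. A *v axis i 1 = B *v f i" by metis
  have "A *v axis i 1 = column i A" for i
    by (simp add: column_def matrix_vector_mult_def vec_eq_iff axis_def mult_delta_right)
  \<comment> \<open>The preimages \<open>f j\<close> become the columns of the factor, hence the
    swapped indices.\<close>
  hence "A = B ** (\<chi> i j. f j $ i)"
    using f by (simp add: vec_eq_iff column_def matrix_vector_mult_def matrix_matrix_mult_def)
  then show thesis by (rule that)
qed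

text \<open>The left factor makes multiplication by \<open>X\<close> injective on the range of X^k.
  An injective map preserves dimension, so the range of X^(k+1), a subspace of that range, fills it,
  and this supplies the right factor.\<close>

lemma mat_pow_left_factor_imp_right_factor:
  fixes X :: "'a::field ^ 'n ^ 'n"
  assumes V: "mat_pow X k = V ** mat_pow X (Suc k)"
  obtains U where "mat_pow X k = mat_pow X (Suc k) ** U"
proof -
  let ?W = "range ((*v) (mat_pow X k))"
  have W: "vec.subspace ?W"
    by (intro vec.subspace_image vec.subspace_UNIV)
  have img: "(*v) X ` ?W = range ((*v) (mat_pow X (Suc k)))"
    by (auto simp: image_comp o_def matrix_vector_mul_assoc)
  have sub: "range ((*v) (mat_pow X (Suc k))) \<subseteq> ?W"
    by (auto simp: mat_pow_Suc2 matrix_vector_mul_assoc [symmetric] simp del: mat_pow.simps)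
  have "x = y" if "x \<in> ?W" "y \<in> ?W" "X *v x = X *v y" for x y
  proof -
    from that obtain u v where uv: "x = mat_pow X k *v u" "y = mat_pow X k *v v" by auto
    have "mat_pow X (Suc k) *v u = mat_pow X (Suc k) *v v"
      using that(3) by (simp add: uv matrix_vector_mul_assoc)
    then show "x = y"
      by (metis V uv matrix_vector_mul_assoc)
  qed
  then have "inj_on ((*v) X) ?W" by (auto simp: inj_on_def)
  then have "vec.dim ((*v) X ` ?W) = vec.dim ?W"
    using W by (intro vec.dim_image_eq matrix_vector_mul_linear_gen) (simp only: vec.span_eq_iff [THEN iffD2])
  then have "range ((*v) (mat_pow X (Suc k))) = ?W"
    using sub W unfolding img
    by (intro vec.subspace_dim_equal vec.subspace_image vec.subspace_UNIV) auto
  then show thesis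
    using range_subset_imp_right_factor that by (metis order_refl)
qed

section \<open>Existence and uniqueness of the Drazin inverse\<close>

lemma rank_mat_pow_Suc_le:
  fixes X :: "'a::field ^ 'n ^ 'n"
  shows "rank (mat_pow X (Suc n)) \<le> rank (mat_pow X n)"
  by (simp add: rank_mult_le_right)

text \<open>\<open>LEAST\<close> is meaningful only if some exponent qualifies. One of minimal rank
  does, since the rank never grows from one power to the next.\<close>

lemma rank_mat_index:
  fixes X :: "'a::field ^ 'n ^ 'n"
  shows "rank (mat_pow X (mat_index X)) = rank (mat_pow X (Suc (mat_index X)))"
proof -
  obtain k where "\<And>j. rank (mat_pow X k) \<le> rank (mat_pow X j)"
    using ex_has_least_nat [of "\<lambda>_. True" 0 "\<lambda>k. rank (mat_pow X k)"] by auto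
  then have "rank (mat_pow X k) = rank (mat_pow X (k + 1))"
    using rank_mat_pow_Suc_le [of X k] by (simp add: le_antisym del: mat_pow.simps)
  then show ?thesis
    using LeastI [of "\<lambda>k. rank (mat_pow X k) = rank (mat_pow X (k + 1))"]
    unfolding mat_index_def by (metis Suc_eq_plus1)
qed

text \<open>Both matrices turn out to be \<open>Y ** X ** Y'\<close>. The exponents \<open>n\<close>
  and \<open>m\<close> are left free so that a candidate checked at an exponent other than the index
  is covered too.\<close>

lemma drazin_unique:
  assumes Y: "X ** Y = Y ** X" "Y ** X ** Y = Y" "mat_pow X n = mat_pow X (Suc n) ** Y"
    and Y': "X ** Y' = Y' ** X" "Y' ** X ** Y' = Y'" "mat_pow X m = mat_pow X (Suc m) ** Y'"
  shows "Y = Y'"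
proof -
  have exp: "W = mat_pow W (Suc j) ** mat_pow X j" "W = mat_pow X j ** mat_pow W (Suc j)"
    if W: "X ** W = W ** X" "W ** X ** W = W" for W j
  proof -
    show *: "W = mat_pow W (Suc j) ** mat_pow X j"
    proof (induction j)
      case (Suc j)
      have "mat_pow W (Suc (Suc j)) ** mat_pow X (Suc j) = W ** (mat_pow W (Suc j) ** mat_pow X j) ** X"
        by (metis mat_pow.simps(2) mat_pow_Suc2 matrix_mul_assoc)
      also have "\<dots> = W" using Suc W by (metis matrix_mul_assoc)
      finally show ?case by simp
    qed simp
    have "mat_pow X j ** mat_pow W (Suc j) = mat_pow W (Suc j) ** mat_pow X j"
      using W(1) by (metis mat_pow_intertwine)
    with * show "W = mat_pow X j ** mat_pow W (Suc j)" by simp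
  qed
  \<comment> \<open>The power equation persists from \<open>i\<close> to every larger exponent, so
    both matrices can be compared at the common exponent \<open>max n m\<close>.\<close>
  have pow: "mat_pow X j = mat_pow X (Suc j) ** W" "mat_pow X j = W ** mat_pow X (Suc j)"
    if W: "X ** W = W ** X" "mat_pow X i = mat_pow X (Suc i) ** W" and "i \<le> j" for W i j
  proof -
    obtain l where l: "j = l + i" using \<open>i \<le> j\<close> by (metis add.commute le_iff_add)
    show "mat_pow X j = mat_pow X (Suc j) ** W"
      unfolding l using W(2) by (metis add_Suc_right mat_pow_add matrix_mul_assoc)
    then show "mat_pow X j = W ** mat_pow X (Suc j)"
      using mat_pow_intertwine W(1) by metis
  qed
  define j where "j = max n m"
  have "Y = mat_pow Y (Suc j) ** mat_pow X j" using exp Y by blast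
  also have "\<dots> = mat_pow Y (Suc j) ** mat_pow X (Suc j) ** Y'"
    by (metis pow(1) [OF Y'(1,3)] j_def max.cobounded2 matrix_mul_assoc)
  also have "\<dots> = Y ** X ** Y'"
    using exp(1) [OF Y(1,2), of j] by (metis mat_pow_Suc2 matrix_mul_assoc)
  finally have 1: "Y = Y ** X ** Y'" .
  have "Y' = mat_pow X j ** mat_pow Y' (Suc j)" using exp Y' by blast
  also have "\<dots> = Y ** mat_pow X (Suc j) ** mat_pow Y' (Suc j)"
    using pow(2) [OF Y(1,3), of j] by (simp add: j_def del: mat_pow.simps)
  also have "\<dots> = Y ** X ** Y'"
    using exp(2) [OF Y'(1,2), of j] by (metis mat_pow.simps(2) matrix_mul_assoc)
  finally show ?thesis using 1 by simp
qed

text \<open>Equality of ranks at the index gives a left factor \<open>V\<close>, and then a right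
  factor \<open>U\<close>, of X^k through X^(k+1). The inverse is built explicitly from them;
  uniqueness then justifies \<open>THE\<close>.\<close>

lemma is_drazin_inverse_drazin:
  fixes X :: "'a::field ^ 'n ^ 'n"
  shows "is_drazin_inverse X (drazin X)"
proof -
  define k where "k = mat_index X"
  obtain V where V: "mat_pow X k = V ** mat_pow X (Suc k)"
    using rank_mult_eq_imp_left_factor [of X "mat_pow X k"] rank_mat_index [of X]
    by (metis k_def mat_pow.simps(2))
  obtain U where U: "mat_pow X k = mat_pow X (Suc k) ** U"
    using mat_pow_left_factor_imp_right_factor [OF V] .
  note rU = mat_pow_factor_right [OF U] and lV = mat_pow_factor_left [OF V]
  define Y where "Y = mat_pow X k ** mat_pow U (Suc k)"
  \<comment> \<open>Both forms equal V^(k+1) X^(2k+1) U^(k+1). The form in \<open>U\<close> suits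
    \<open>X ** Y\<close>, the form in \<open>V\<close> suits \<open>Y ** X\<close>.\<close>
  have Y2: "Y = mat_pow V (Suc k) ** mat_pow X k"
    unfolding Y_def by (metis lV [of "Suc k"] rU [of "Suc k"] matrix_mul_assoc)
  have XY: "X ** Y = mat_pow X k ** mat_pow U k"
    unfolding Y_def by (metis U mat_pow.simps(2) matrix_mul_assoc)
  have YX: "Y ** X = mat_pow V k ** mat_pow X k"
    unfolding Y2 by (metis V mat_pow_Suc2 matrix_mul_assoc)
  have "mat_pow V k ** mat_pow X k = mat_pow X k ** mat_pow U k"
    by (metis lV [of "k"] rU [of "k"] matrix_mul_assoc)
  with XY YX have comm: "X ** Y = Y ** X" by simp
  \<comment> \<open>The product is V^k X^k X^k U^(k+1), where V^k X^(2k) collapses to X^k.\<close>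
  have "Y ** X ** Y = Y"
    by (metis XY YX Y_def lV mat_pow_add matrix_mul_assoc)
  moreover have "mat_pow X k = mat_pow X (Suc k) ** Y"
    unfolding Y_def by (metis add_Suc_right add_Suc rU mat_pow_add matrix_mul_assoc)
  ultimately have "is_drazin_inverse X Y"
    using comm by (simp add: is_drazin_inverse_def k_def)
  moreover have "Y' = Y''" if "is_drazin_inverse X Y'" "is_drazin_inverse X Y''" for Y' Y''
    using that unfolding is_drazin_inverse_def
    by (metis Suc_eq_plus1 drazin_unique)
  ultimately show ?thesis
    unfolding drazin_def by (metis theI)
qed

section \<open>Commutation, power and intertwining rules for the Drazin inverse\<close>

lemma drazin_commute: "X ** drazin X = drazin X ** X"
  and drazin_outer: "drazin X ** X ** drazin X = drazin X"
  and mat_pow_index_drazin: "mat_pow X (mat_index X) = mat_pow X (Suc (mat_index X)) ** drazin X"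
  using is_drazin_inverse_drazin [of X] by (simp_all add: is_drazin_inverse_def)

lemma drazin_eqI:
  assumes "X ** Y = Y ** X" "Y ** X ** Y = Y" "mat_pow X n = mat_pow X (Suc n) ** Y"
  shows "drazin X = Y"
  using drazin_unique [OF drazin_commute drazin_outer mat_pow_index_drazin assms] .

lemma drazin_commute_mat_pow: "mat_pow X n ** drazin X = drazin X ** mat_pow X n"
  by (rule mat_pow_intertwine) (rule drazin_commute)

lemma drazin_eq_pow: "drazin X = mat_pow (drazin X) (Suc n) ** mat_pow X n"
proof (induction n)
  case (Suc n)
  have "mat_pow (drazin X) (Suc (Suc n)) ** mat_pow X (Suc n) =
      drazin X ** (mat_pow (drazin X) (Suc n) ** mat_pow X n) ** X"
    by (metis mat_pow.simps(2) mat_pow_Suc2 matrix_mul_assoc)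
  also have "\<dots> = drazin X ** X ** drazin X"
    using Suc by (metis drazin_commute matrix_mul_assoc)
  finally show ?case by (simp only: drazin_outer)
qed simp

lemma drazin_proj_commute: "X ** drazin_proj X = drazin_proj X ** X"
  by (simp add: drazin_proj_def mat_diff_ldistrib mat_diff_rdistrib)
     (metis drazin_commute matrix_mul_assoc)

lemma mat_pow_drazin_proj_commute: "mat_pow X n ** drazin_proj X = drazin_proj X ** mat_pow X n"
  by (rule mat_pow_intertwine) (rule drazin_proj_commute)

lemma mat_pow_index_drazin_proj:
  assumes "mat_index X \<le> n"
  shows "mat_pow X n ** drazin_proj X = 0"
proof -
  obtain l where l: "n = l + mat_index X" using assms by (metis add.commute le_iff_add)
  have "mat_pow X (mat_index X) ** drazin_proj X = 0"
    using mat_pow_index_drazin [of X]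
    by (simp add: drazin_proj_def mat_diff_ldistrib mat_pow_Suc2 matrix_mul_assoc del: mat_pow.simps)
  then show ?thesis
    by (simp add: l mat_pow_add matrix_mul_assoc [symmetric])
qed

text \<open>Both \<open>drazin Z ** V ** drazin_proj T\<close> and
  \<open>drazin_proj Z ** V ** drazin T\<close> vanish: a high power is moved through
  \<open>V\<close> until it meets a projection that it annihilates. Hence both sides equal
  \<open>drazin Z ** V ** T ** drazin T\<close>.\<close>

lemma drazin_intertwine:
  assumes "Z ** V = V ** T"
  shows "drazin Z ** V = V ** drazin T"
proof -
  \<comment> \<open>This exponent is large enough for both \<open>Z\<close> and
    \<open>T\<close>.\<close>
  define n where "n = mat_index Z + mat_index T"
  have pow: "mat_pow Z n ** V = V ** mat_pow T n"
    using assms by (rule mat_pow_intertwine)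
  have "drazin Z ** V ** drazin_proj T = mat_pow (drazin Z) (Suc n) ** (mat_pow Z n ** V) ** drazin_proj T"
    using drazin_eq_pow [of Z n] by (metis matrix_mul_assoc)
  also have "\<dots> = mat_pow (drazin Z) (Suc n) ** V ** (mat_pow T n ** drazin_proj T)"
    by (simp only: pow matrix_mul_assoc)
  also have "\<dots> = 0"
    by (simp add: mat_pow_index_drazin_proj n_def)
  finally have 1: "drazin Z ** V = drazin Z ** V ** T ** drazin T"
    by (simp add: drazin_proj_def mat_diff_ldistrib matrix_mul_assoc)
  have "drazin T = mat_pow T n ** mat_pow (drazin T) (Suc n)"
    using drazin_eq_pow [of T n] mat_pow_intertwine [OF drazin_commute_mat_pow [symmetric]] by metis
  then have "drazin_proj Z ** V ** drazin T = drazin_proj Z ** (V ** mat_pow T n) ** mat_pow (drazin T) (Suc n)"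
    by (metis matrix_mul_assoc)
  also have "\<dots> = (mat_pow Z n ** drazin_proj Z) ** V ** mat_pow (drazin T) (Suc n)"
    by (simp only: pow [symmetric] matrix_mul_assoc mat_pow_drazin_proj_commute)
  also have "\<dots> = 0"
    by (simp add: mat_pow_index_drazin_proj n_def)
  finally have "V ** drazin T = Z ** drazin Z ** V ** drazin T"
    by (simp add: drazin_proj_def mat_diff_rdistrib matrix_mul_assoc)
  also have "\<dots> = drazin Z ** V ** T ** drazin T"
    by (metis assms drazin_commute matrix_mul_assoc)
  finally show ?thesis using 1 by simp
qed

lemma drazin_proj_intertwine:
  assumes "Z ** V = V ** T"
  shows "drazin_proj Z ** V = V ** drazin_proj T"
  by (simp add: drazin_proj_def mat_diff_ldistrib mat_diff_rdistrib)
     (metis assms drazin_intertwine [OF assms] matrix_mul_assoc)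

text \<open>\<open>S\<close> leaves the range of \<open>P\<close> invariant and acts there as
  \<open>T\<close>, while \<open>Q ** S\<close> is the part of \<open>A\<close> cut out by
  \<open>Q\<close>, nilpotent by \<open>nil\<close>. The sum is the off-diagonal block of the
  inverse; the whole candidate is verified with \<open>drazin_eqI\<close>.\<close>

lemma drazin_block_triangular:
  fixes S A P T :: "'a::field ^ 'n ^ 'n"
  defines "Q \<equiv> mat 1 - P"
  assumes PP: "P ** P = P" and SP: "S ** P = T" and PT: "P ** T = T"
    and QS: "Q ** S = Q ** A" and QA: "A ** Q = Q ** A" and nil: "mat_pow A k ** Q = 0"
  shows "drazin S = drazin T + (\<Sum>i<k. mat_pow (drazin T) (i + 2) ** S ** mat_pow A i ** Q)"
proof -
  define R where "R = drazin T"
  \<comment> \<open>\<open>G\<close> is chosen so that \<open>S ** Y = T ** R + G\<close>; its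
    summands carry one factor \<open>R\<close> fewer than those of the claim.\<close>
  define G where "G = (\<Sum>i<k. mat_pow R (Suc i) ** S ** mat_pow A i ** Q)"
  define Y where "Y = R + R ** G"
  have Y: "Y = drazin T + (\<Sum>i<k. mat_pow R (i + 2) ** S ** mat_pow A i ** Q)"
    by (simp add: Y_def G_def R_def mat_sum_ldistrib matrix_mul_assoc)
  have TP: "T ** P = T" by (metis PP SP matrix_mul_assoc)
  have PR: "P ** R = R"
    unfolding R_def by (metis PT drazin_commute drazin_outer matrix_mul_assoc)
  have TR: "T ** R = R ** T" and RTR: "R ** T ** R = R"
    unfolding R_def by (rule drazin_commute drazin_outer)+
  have QP: "Q ** P = 0" by (simp add: Q_def mat_diff_rdistrib PP)
  have QApow: "mat_pow A n ** Q = Q ** mat_pow A n" for n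
    using QA by (rule mat_pow_intertwine)
  have SR: "S ** R = T ** R" by (metis PR SP matrix_mul_assoc)
  have S_split: "S = T + S ** Q"
    by (simp add: Q_def mat_diff_ldistrib SP)
  have GP: "G ** P = 0"
    by (simp add: G_def mat_sum_rdistrib matrix_mul_assoc [symmetric] QP)
  have GR: "G ** R = 0" by (metis GP PR matrix_mul_assoc mat_mult_zero_left)
  have GT: "G ** T = 0" by (metis GP PT matrix_mul_assoc mat_mult_zero_left)
  have PG: "R ** T ** G = G"
    unfolding G_def mat_sum_ldistrib by (simp add: matrix_mul_assoc RTR)
  have SY: "S ** Y = T ** R + G"
    unfolding Y_def by (metis matrix_add_ldistrib PG SR TR matrix_mul_assoc)
  \<comment> \<open>\<open>Q\<close> turns the trailing \<open>S\<close> into \<open>A\<close>,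
    which commutes with \<open>Q\<close> and joins A^i.\<close>
  have step: "mat_pow R (Suc i) ** S ** mat_pow A i ** Q ** S =
      mat_pow R (Suc i) ** S ** mat_pow A (Suc i) ** Q" for i
    by (metis QS QA QApow mat_pow_Suc2 matrix_mul_assoc)
  \<comment> \<open>By \<open>step\<close>, \<open>R ** (G ** S)\<close> is \<open>G\<close> with
    its index shifted by one. \<open>R ** S ** Q\<close> is the missing summand at 0, and the
    surplus summand at \<open>k\<close> vanishes by \<open>nil\<close>.\<close>
  have RGS: "R ** S ** Q + R ** (G ** S) = G"
  proof -
    let ?f = "\<lambda>i. mat_pow R (Suc i) ** S ** mat_pow A i ** Q"
    have "R ** (G ** S) = (\<Sum>i<k. ?f (Suc i))"
      unfolding G_def mat_sum_ldistrib mat_sum_rdistrib step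
      by (simp add: matrix_mul_assoc)
    then have "R ** S ** Q + R ** (G ** S) = ?f 0 + (\<Sum>i<k. ?f (Suc i))"
      by simp
    also have "\<dots> = (\<Sum>i<k. ?f i) + ?f k"
      by (rule trans [OF sum.lessThan_Suc_shift [symmetric] sum.lessThan_Suc])
    also have "?f k = 0"
      using nil by (metis mat_mult_zero_right matrix_mul_assoc)
    finally show ?thesis by (simp add: G_def)
  qed
  have "Y ** S = R ** S + R ** (G ** S)"
    by (simp add: Y_def mat_add_rdistrib matrix_mul_assoc)
  also have "R ** S = R ** T + R ** S ** Q"
    by (metis S_split matrix_add_ldistrib matrix_mul_assoc)
  finally have comm: "S ** Y = Y ** S"
    using RGS by (simp add: SY TR add.assoc)
  have outer: "Y ** S ** Y = Y"
  proof -
    have "Y ** S ** Y = (R + R ** G) ** (T ** R + G)"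
      by (metis SY Y_def matrix_mul_assoc)
    also have "\<dots> = R ** T ** R + R ** G + R ** (G ** T) ** R + R ** (G ** G)"
      by (simp add: matrix_add_ldistrib mat_add_rdistrib matrix_mul_assoc)
    also have "G ** G = 0"
      by (metis GR PG mat_mult_zero_left matrix_mul_assoc)
    finally show ?thesis by (simp add: GT RTR Y_def)
  qed
  define j where "j = mat_index T"
  \<comment> \<open>Since \<open>T ** P = T\<close>, the factor \<open>P\<close> on the right-hand
    side makes a difference only at exponent 0.\<close>
  have SjP: "mat_pow S j ** P = mat_pow T j ** P" for j
  proof (induction j)
    case (Suc j)
    have "P ** mat_pow T j ** P = mat_pow T j ** P"
      by (cases j) (simp_all add: PP matrix_mul_assoc PT)
    then show ?case
      by (metis Suc SP TP mat_pow.simps(2) matrix_mul_assoc)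
  qed simp
  have QSk: "Q ** mat_pow S n = Q ** mat_pow A n" for n
  proof (induction n)
    case (Suc n)
    then show ?case by (metis QS QA mat_pow.simps(2) matrix_mul_assoc)
  qed simp
  have "Q ** mat_pow S k = 0" using QSk QApow nil by metis
  then have PSk: "P ** mat_pow S k = mat_pow S k"
    by (simp add: Q_def mat_diff_rdistrib)
  \<comment> \<open>The defect of the power equation vanishes at exponent \<open>j + k\<close>: S^k
    maps into the range of \<open>P\<close>, where \<open>S ** Y\<close> acts as
    \<open>T ** R\<close> and S^j as T^j, and T^j annihilates \<open>drazin_proj T\<close>.\<close>
  have "mat_pow S (j + k) - mat_pow S (Suc (j + k)) ** Y = mat_pow S j ** ((mat 1 - S ** Y) ** mat_pow S k)"
  proof -
    have "mat_pow S (Suc (j + k)) ** Y = mat_pow S j ** (mat_pow S (Suc k) ** Y)"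
      by (metis add_Suc_right mat_pow_add matrix_mul_assoc)
    also have "mat_pow S (Suc k) ** Y = S ** Y ** mat_pow S k"
      using mat_pow_intertwine [OF comm, of k] by (metis mat_pow.simps(2) matrix_mul_assoc)
    finally show ?thesis
      by (simp add: mat_diff_rdistrib mat_diff_ldistrib mat_pow_add matrix_mul_assoc)
  qed
  also have "\<dots> = mat_pow S j ** ((mat 1 - S ** Y) ** P) ** mat_pow S k"
    by (metis PSk matrix_mul_assoc)
  also have "(mat 1 - S ** Y) ** P = P ** (drazin_proj T ** P)"
    by (simp add: SY mat_diff_rdistrib mat_diff_ldistrib mat_add_rdistrib GP drazin_proj_def R_def [symmetric]
        PP PT matrix_mul_assoc)
  also have "mat_pow S j ** (P ** (drazin_proj T ** P)) = mat_pow T j ** (P ** drazin_proj T) ** P"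
    by (metis SjP matrix_mul_assoc)
  also have "P ** drazin_proj T = drazin_proj T ** P"
    by (simp add: drazin_proj_def mat_diff_ldistrib mat_diff_rdistrib R_def [symmetric] PT matrix_mul_assoc)
       (metis TP TR matrix_mul_assoc)
  also have "mat_pow T j ** (drazin_proj T ** P) = 0"
    by (simp add: matrix_mul_assoc mat_pow_index_drazin_proj j_def)
  finally have "mat_pow S (j + k) = mat_pow S (Suc (j + k)) ** Y"
    by simp
  with comm outer have "drazin S = Y" by (rule drazin_eqI)
  then show ?thesis unfolding Y R_def .
qed

text \<open>The delicate point is the boundary term of the telescoping sum. Since \<open>s\<close>
  bounds the index of \<open>Z\<close> and not that of \<open>T\<close>, the matrix
  \<open>mat_pow T s ** drazin_proj T\<close> need not vanish; its product with
  \<open>drazin A\<close> does.\<close>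

lemma drazin_eq_of_intertwining:
  fixes A T P :: "'a::field ^ 'n ^ 'n" and V :: "'a ^ 'n ^ 'm" and C :: "'a ^ 'm ^ 'n" and Z :: "'a ^ 'm ^ 'm"
  defines "P \<equiv> A ** drazin A"
  assumes T: "T = A ** P - C ** V" and PT: "P ** T = T" and VT: "Z ** V = V ** T" and s: "mat_index Z \<le> s"
  shows "drazin T = drazin A + drazin A ** C ** drazin Z ** V
     - (\<Sum>i<s. mat_pow (drazin A) (i + 2) ** C ** mat_pow Z i ** drazin_proj Z ** V)"
proof -
  define a where "a = drazin A"
  define R where "R = drazin T"
  define W where "W i = mat_pow T i ** drazin_proj T" for i
  have aA: "a ** A = P" and aP: "a ** P = a"
    unfolding a_def P_def by (metis drazin_commute, metis drazin_outer matrix_mul_assoc)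
  have AP: "A ** P = P ** A"
    unfolding P_def by (metis drazin_commute matrix_mul_assoc)
  have PP: "P ** P = P"
    using aA aP AP by (metis matrix_mul_assoc)
  have PR: "P ** R = R"
    unfolding R_def by (metis PT drazin_commute drazin_outer matrix_mul_assoc)
  have CV: "C ** V = A ** P - T" using T by simp
  have aCV: "a ** C ** V = P - a ** T"
    by (simp add: matrix_mul_assoc [symmetric] CV mat_diff_ldistrib) (simp add: matrix_mul_assoc aA PP)
  have W_Suc: "T ** W i = W (Suc i)" "W i ** T = W (Suc i)" for i
    unfolding W_def
    by (simp add: matrix_mul_assoc) (metis drazin_proj_commute mat_pow_Suc2 matrix_mul_assoc)
  \<comment> \<open>Moving \<open>V\<close> to the right replaces \<open>T\<close> by
    \<open>Z\<close>, whose index is at most \<open>s\<close>.\<close>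
  have "V ** W s = mat_pow Z s ** drazin_proj Z ** V"
    unfolding W_def using mat_pow_intertwine [OF VT, of s] drazin_proj_intertwine [OF VT]
    by (metis matrix_mul_assoc)
  also have "\<dots> = 0" using s by (simp add: mat_pow_index_drazin_proj)
  finally have VW: "V ** W s = 0" .
  have VW: "V ** W (s + n) = 0" for n
    by (induction n) (use VW in \<open>simp_all flip: W_Suc(2) add: matrix_mul_assoc\<close>)
  \<comment> \<open>Where \<open>V\<close> annihilates \<open>W\<close>, the relation
    \<open>C ** V = A ** P - T\<close> says that \<open>T\<close> acts as
    \<open>A ** P\<close>.\<close>
  have AW: "A ** P ** W (s + n) = W (s + Suc n)" for n
  proof -
    have "A ** P ** W (s + n) - T ** W (s + n) = C ** (V ** W (s + n))"
      by (simp only: CV mat_diff_rdistrib matrix_mul_assoc)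
    then show ?thesis by (simp add: VW W_Suc)
  qed
  have aW: "a ** W (s + Suc n) = P ** W (s + n)" for n
    by (metis AW aA PP matrix_mul_assoc)
  have W0: "W (s + mat_index T) = 0"
    by (simp add: W_def mat_pow_index_drazin_proj)
  \<comment> \<open>By \<open>aW\<close> each extra factor \<open>a\<close> undoes one step of
    \<open>W\<close>. So \<open>a ** W s\<close> can be rewritten with \<open>W\<close> at an index
    so high that it is 0.\<close>
  have "mat_pow a (Suc n) ** W (s + n) = a ** W s" for n
  proof (induction n)
    case (Suc n)
    have "mat_pow a (Suc (Suc n)) ** W (s + Suc n) = mat_pow a (Suc n) ** (P ** W (s + n))"
      by (metis aW mat_pow_Suc2 matrix_mul_assoc)
    also have "\<dots> = mat_pow a (Suc n) ** W (s + n)"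
      by (metis aP mat_pow_Suc2 matrix_mul_assoc)
    finally show ?case using Suc by simp
  qed simp
  from this [of "mat_index T"] have aWs: "a ** W s = 0" by (simp add: W0)
  \<comment> \<open>With \<open>V\<close> moved to the left next to \<open>C\<close>, the identity
    \<open>a ** C ** V = P - a ** T\<close> splits each summand into two consecutive terms of one
    sequence.\<close>
  have term_eq: "mat_pow a (i + 2) ** C ** mat_pow Z i ** drazin_proj Z ** V =
      mat_pow a (Suc i) ** W i - mat_pow a (Suc (Suc i)) ** W (Suc i)" for i
  proof -
    have "mat_pow Z i ** drazin_proj Z ** V = V ** W i"
      unfolding W_def using mat_pow_intertwine [OF VT, of i] drazin_proj_intertwine [OF VT]
      by (metis matrix_mul_assoc)
    then have "mat_pow a (i + 2) ** C ** mat_pow Z i ** drazin_proj Z ** V =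
        mat_pow a (Suc i) ** (a ** C ** V) ** W i"
      by (metis add_2_eq_Suc' mat_pow_Suc2 matrix_mul_assoc)
    also have "\<dots> = mat_pow a (Suc i) ** P ** W i - mat_pow a (Suc i) ** a ** (T ** W i)"
      by (simp only: aCV mat_diff_ldistrib mat_diff_rdistrib matrix_mul_assoc)
    also have "mat_pow a (Suc i) ** P = mat_pow a (Suc i)"
      by (metis aP mat_pow_Suc2 matrix_mul_assoc)
    finally show ?thesis by (simp only: W_Suc mat_pow_Suc2 [of a "Suc i"])
  qed
  have "(\<Sum>i<s. mat_pow a (i + 2) ** C ** mat_pow Z i ** drazin_proj Z ** V) =
      mat_pow a (Suc 0) ** W 0 - mat_pow a (Suc s) ** W s"
    unfolding term_eq by (rule sum_lessThan_telescope')
  also have "mat_pow a (Suc s) ** W s = 0"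
    by (metis aWs mat_mult_zero_right mat_pow_Suc2 matrix_mul_assoc)
  finally have sum: "(\<Sum>i<s. mat_pow a (i + 2) ** C ** mat_pow Z i ** drazin_proj Z ** V) = a - a ** T ** R"
    by (simp add: W_def drazin_proj_def R_def mat_diff_ldistrib matrix_mul_assoc)
  \<comment> \<open>This product is \<open>R - a ** T ** R\<close> and the sum is
    \<open>a - a ** T ** R\<close>, so adding \<open>a\<close> to their difference leaves
    \<open>R\<close>.\<close>
  have "a ** C ** drazin Z ** V = a ** C ** V ** R"
    unfolding R_def by (metis drazin_intertwine [OF VT] matrix_mul_assoc)
  also have "\<dots> = R - a ** T ** R"
    by (simp add: aCV mat_diff_rdistrib PR)
  finally show ?thesis
    unfolding a_def [symmetric] R_def [symmetric] sum by simp
qed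

section \<open>Application to the block data \<open>A\<close>, \<open>B\<close>, \<open>C\<close>,
  \<open>D\<close>\<close>

theorem theorem3p4:
  fixes A S S\<^sub>A :: "complex ^ 'n ^ 'n"
    and D Z :: "complex ^ 'm ^ 'm"
    and B :: "complex ^ 'n ^ 'm"
    and C :: "complex ^ 'm ^ 'n"
    and k s :: nat
  assumes S_def: "S = A - C ** drazin D ** B"
    and Z_def: "Z = D - B ** drazin A ** C"
    and SA_def: "S\<^sub>A = A ** drazin A ** S ** A ** drazin A"
    and k_def: "k = mat_index A"
    and s_def: "s = mat_index Z"
    and h1: "drazin_proj A ** C ** drazin D ** B = 0"
    and h2: "drazin_proj D ** B ** drazin A ** C = 0"
    and h3: "drazin D ** B ** A ** drazin A = drazin D ** D ** B ** drazin A"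
  shows "drazin S = drazin S\<^sub>A
           + (\<Sum>i<k. mat_pow (drazin S\<^sub>A) (i + 2) ** S ** mat_pow A i ** drazin_proj A)
       \<and> drazin S\<^sub>A = drazin A
           + drazin A ** C ** drazin Z ** drazin D ** B ** A ** drazin A
           - (\<Sum>i<s. mat_pow (drazin A) (i + 2) ** C ** D ** drazin D ** mat_pow Z i
                        ** drazin_proj Z ** drazin D ** B ** A ** drazin A)"
proof -
  define a d where "a = drazin A" and "d = drazin D"
  define P Q where "P = A ** a" and "Q = D ** d"
  define V where "V = d ** B ** P"
  have AP: "A ** P = P ** A" and aP: "a ** P = a" and aA: "a ** A = P"
    unfolding P_def a_def by (metis drazin_commute matrix_mul_assoc, metis drazin_outer matrix_mul_assoc, metis drazin_commute)
  have PP: "P ** P = P" by (metis P_def aP matrix_mul_assoc)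
  have dD: "d ** D = Q" and Qd: "Q ** d = d"
    unfolding Q_def d_def by (metis drazin_commute, metis drazin_outer drazin_commute)
  have pA: "drazin_proj A = mat 1 - P" by (simp add: drazin_proj_def P_def a_def)
  have PCdB: "P ** (C ** d ** B) = C ** d ** B"
    using h1 by (metis d_def eq_iff_diff_eq_0 mat_diff_rdistrib matrix_mul_assoc matrix_mul_lid pA)
  have QBaC: "Q ** B ** a ** C = B ** a ** C"
    using h2 by (simp add: drazin_proj_def Q_def a_def d_def mat_diff_rdistrib)
  \<comment> \<open>By \<open>h3\<close>, \<open>V\<close> has a second form ending in
    \<open>a\<close>, which makes \<open>V ** A\<close> and \<open>V ** C\<close>
    computable.\<close>
  have V_eq: "V = Q ** B ** a"
    using h3 dD by (simp add: V_def P_def a_def d_def matrix_mul_assoc)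
  have QV: "Q ** V = V" by (metis V_def Qd matrix_mul_assoc)
  have SP_V: "S ** P = A ** P - C ** V"
    by (simp add: S_def V_def mat_diff_rdistrib matrix_mul_assoc d_def)
  \<comment> \<open>By \<open>PCdB\<close> the columns of \<open>C ** V\<close> lie in the range of
    \<open>P\<close>, as do those of \<open>A ** P\<close>. So \<open>S\<close> leaves this range
    invariant, and \<open>P ** S ** P\<close>, which is \<open>S\<^sub>A\<close>, reduces to
    \<open>S ** P\<close>.\<close>
  have PSP: "P ** (S ** P) = S ** P"
    by (simp add: SP_V mat_diff_ldistrib V_def)
       (metis AP PP PCdB matrix_mul_assoc)
  have T_eq: "S\<^sub>A = S ** P"
    unfolding SA_def by (metis P_def a_def PSP matrix_mul_assoc)
  have PT: "P ** S\<^sub>A = S\<^sub>A" using T_eq PSP by simp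
  have T: "S\<^sub>A = A ** P - C ** V" using T_eq SP_V by simp
  have VA: "V ** A ** P = D ** V"
  proof -
    have "V ** A ** P = Q ** B ** P" by (metis V_eq aA PP matrix_mul_assoc)
    then show ?thesis by (simp add: V_def Q_def matrix_mul_assoc)
  qed
  \<comment> \<open>By \<open>VA\<close>, \<open>V ** S\<^sub>A\<close> is
    \<open>D ** V - V ** C ** V\<close>; by \<open>V_eq\<close> and \<open>QBaC\<close>, that is by
    \<open>h2\<close>, \<open>V ** C\<close> is \<open>B ** a ** C\<close>.\<close>
  have VT: "Z ** V = V ** S\<^sub>A"
    unfolding T Z_def a_def [symmetric]
    by (simp add: mat_diff_ldistrib mat_diff_rdistrib)
       (metis VA V_eq QBaC matrix_mul_assoc)
  \<comment> \<open>Intertwining brings \<open>V\<close> to the front, where it absorbs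
    \<open>Q\<close>. This is how the factor \<open>D ** drazin D\<close> enters the stated
    sum.\<close>
  have QZi: "Q ** (mat_pow Z i ** drazin_proj Z ** V) = mat_pow Z i ** drazin_proj Z ** V" for i
    using mat_pow_intertwine [OF VT, of i] drazin_proj_intertwine [OF VT] QV
    by (metis matrix_mul_assoc)
  have QS: "drazin_proj A ** S = drazin_proj A ** A"
    using h1 by (simp add: S_def mat_diff_ldistrib matrix_mul_assoc)
  have "drazin S = drazin S\<^sub>A
           + (\<Sum>i<k. mat_pow (drazin S\<^sub>A) (i + 2) ** S ** mat_pow A i ** drazin_proj A)"
    unfolding pA
  proof (rule drazin_block_triangular [OF PP T_eq [symmetric] PT])
    show "(mat 1 - P) ** S = (mat 1 - P) ** A" using QS by (simp add: pA)
    show "A ** (mat 1 - P) = (mat 1 - P) ** A" using drazin_proj_commute [of A] by (simp add: pA)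
    show "mat_pow A k ** (mat 1 - P) = 0"
      using mat_pow_index_drazin_proj [of A k] by (simp add: pA k_def)
  qed
  moreover have "drazin S\<^sub>A = a + a ** C ** drazin Z ** V
      - (\<Sum>i<s. mat_pow a (i + 2) ** C ** mat_pow Z i ** drazin_proj Z ** V)"
    unfolding a_def by (rule drazin_eq_of_intertwining) (use T PT VT s_def in \<open>simp_all add: P_def a_def\<close>)
  moreover have "mat_pow a (i + 2) ** C ** mat_pow Z i ** drazin_proj Z ** V =
      mat_pow a (i + 2) ** C ** D ** d ** mat_pow Z i ** drazin_proj Z ** d ** B ** A ** a" for i
  proof -
    have "mat_pow a (i + 2) ** C ** mat_pow Z i ** drazin_proj Z ** V =
        mat_pow a (i + 2) ** C ** (Q ** (mat_pow Z i ** drazin_proj Z ** V))"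
      unfolding QZi by (simp only: matrix_mul_assoc)
    then show ?thesis by (simp only: V_def P_def Q_def matrix_mul_assoc)
  qed
  moreover have "a ** C ** drazin Z ** V = a ** C ** drazin Z ** d ** B ** A ** a"
    by (simp only: V_def P_def matrix_mul_assoc)
  ultimately show ?thesis by (simp only: a_def d_def simp_thms)
qed

end
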